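(* Let $K$ be a field of characteristic zero and let $A = K\langle x,y\rangle/\langle xy-yx-x\rangle$. For integers $k \ge 1$, $\ell \ge 0$ put $w_{k,\ell} = (xy^{k}-y^{k}x)x^{\ell} \in A$, and let $$W = \bigoplus_{m\ge 1,\, n\ge 0} K x^{m}y^{n} \subseteq A.$$ Then $\{w_{k,\ell}\}_{k\ge 1,\,\ell\ge 0}$ is a $K$-basis of $W$, that is, $$W = \bigoplus_{k\ge 1,\,\ell\ge 0} K w_{k,\ell}.$$
   Context: $K\langle x,y\rangle$ denotes the noncommutative polynomial ring (free associative unital $K$-algebra) in two indeterminates $x,y$, and $\langle xy-yx-x\rangle$ is the two-sided ideal generated by $xy-yx-x$. The images of $x,y$ in the quotient $A$ are again denoted $x,y$, so $xy-yx=x$ in $A$. The algebra $A$ is the universal enveloping algebra of the two-dimensional Lie algebra $Kx\oplus Ky$ with $[x,y]=x$, so by the PBW theorem the monomials $x^my^n$ ($m,n\ge 0$) form a $K$-basis of $A$ and the sum defining $W$ is direct. *)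

theory Defs
  imports Complex_Main "HOL-Library.Poly_Mapping"
begin

text \<open>
  The free algebra is the monoid algebra of the free monoid on two letters.
  Multiplication on \<open>_ \<Rightarrow>\<^sub>0 _\<close> is convolution over an additively written (not necessarily
  commutative) monoid of exponents, so concatenation of words is written \<open>+\<close>.
\<close>

datatype letter = LX | LY

datatype word = Word (letters: "letter list")

instantiation word :: monoid_add
begin

definition zero_word :: word where "0 = Word []"

definition plus_word :: "word \<Rightarrow> word \<Rightarrow> word" where
  "u + v = Word (letters u @ letters v)"

instance
  by standard (simp_all add: zero_word_def plus_word_def)

end

type_synonym 'k free_alg = "word \<Rightarrow>\<^sub>0 'k"

definition indet :: "letter \<Rightarrow> 'k::field free_alg" where
  "indet a = Poly_Mapping.single (Word [a]) 1"

definition scalar :: "'k::field \<Rightarrow> 'k free_alg" where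
  "scalar c = Poly_Mapping.single 0 c"

definition two_sided_ideal :: "'a::ring_1 set \<Rightarrow> bool" where
  "two_sided_ideal I \<longleftrightarrow>
     0 \<in> I \<and> (\<forall>a\<in>I. \<forall>b\<in>I. a + b \<in> I) \<and> (\<forall>a\<in>I. \<forall>r. r * a \<in> I \<and> a * r \<in> I)"

definition rel_ideal :: "'k::field free_alg set" where
  "rel_ideal =
     two_sided_ideal hull {indet LX * indet LY - indet LY * indet LX - indet LX}"

lemma two_sided_ideal_rel_ideal: "two_sided_ideal rel_ideal"
  unfolding rel_ideal_def by (rule hull_in) (auto simp: two_sided_ideal_def)

lemma rel_ideal_zero: "0 \<in> rel_ideal"
  and rel_ideal_add: "a \<in> rel_ideal \<Longrightarrow> b \<in> rel_ideal \<Longrightarrow> a + b \<in> rel_ideal"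
  and rel_ideal_mult_left: "a \<in> rel_ideal \<Longrightarrow> r * a \<in> rel_ideal"
  and rel_ideal_mult_right: "a \<in> rel_ideal \<Longrightarrow> a * r \<in> rel_ideal"
  using two_sided_ideal_rel_ideal unfolding two_sided_ideal_def by blast+

lemma rel_ideal_minus: "a \<in> rel_ideal \<Longrightarrow> - a \<in> rel_ideal"
  using rel_ideal_mult_left[of a "- 1"] by simp

definition rel_cong :: "'k::field free_alg \<Rightarrow> 'k free_alg \<Rightarrow> bool" where
  "rel_cong f g \<longleftrightarrow> f - g \<in> rel_ideal"

lemma equivp_rel_cong: "equivp (rel_cong :: 'k::field free_alg \<Rightarrow> _)"
proof (rule equivpI)
  show "reflp (rel_cong :: 'k free_alg \<Rightarrow> _)"
    by (simp add: reflp_def rel_cong_def rel_ideal_zero)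
  show "symp (rel_cong :: 'k free_alg \<Rightarrow> _)"
    unfolding symp_def rel_cong_def by (metis minus_diff_eq rel_ideal_minus)
  show "transp (rel_cong :: 'k free_alg \<Rightarrow> _)"
    unfolding transp_def rel_cong_def
  proof (intro allI impI)
    fix f g h :: "'k free_alg"
    assume "f - g \<in> rel_ideal" "g - h \<in> rel_ideal"
    from rel_ideal_add[OF this] show "f - h \<in> rel_ideal"
      by simp
  qed
qed

lemma rel_cong_mult:
  assumes "rel_cong f f'" "rel_cong g g'"
  shows "rel_cong (f * g) (f' * g')"
proof -
  have "f * g - f' * g' = (f - f') * g + f' * (g - g')"
    by (simp add: algebra_simps)
  then show ?thesis
    using assms unfolding rel_cong_def
    by (simp add: rel_ideal_add rel_ideal_mult_left rel_ideal_mult_right)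
qed

lemma one_notin_rel_ideal: "1 \<notin> (rel_ideal :: 'k::field free_alg set)"
proof -
  let ?J = "{f :: 'k free_alg. Poly_Mapping.lookup f 0 = 0}"
  have zero_eq: "0 = u + v \<longleftrightarrow> u = 0 \<and> v = 0" for u v :: word
    by (cases u; cases v) (auto simp: zero_word_def plus_word_def)
  have mult: "Poly_Mapping.lookup (f * g) 0 = Poly_Mapping.lookup f 0 * Poly_Mapping.lookup g 0"
    for f g :: "'k free_alg"
  proof -
    have "Poly_Mapping.lookup (f * g) 0 =
        (\<Sum>u. Poly_Mapping.lookup f u * (\<Sum>v. (Poly_Mapping.lookup g v when v = 0) when u = 0))"
      by (simp add: lookup_mult zero_eq when_when conj_commute)
    also have "\<dots> = (\<Sum>u. Poly_Mapping.lookup f u * Poly_Mapping.lookup g 0 when u = 0)"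
      by (intro Sum_any.cong) (auto simp: when_def)
    finally show ?thesis
      by simp
  qed
  have "two_sided_ideal ?J"
    by (auto simp: two_sided_ideal_def lookup_add mult)
  moreover have "indet LX * indet LY - indet LY * indet LX - indet LX \<in> ?J"
    by (simp add: lookup_minus mult) (simp add: indet_def lookup_single zero_word_def)
  ultimately have "rel_ideal \<subseteq> ?J"
    unfolding rel_ideal_def by (intro hull_minimal) auto
  then show ?thesis
    by auto
qed

quotient_type (overloaded) 'k xy_alg = "'k::field free_alg" / rel_cong
  by (rule equivp_rel_cong)

instantiation xy_alg :: (field) ring_1
begin

lift_definition zero_xy_alg :: "'a xy_alg" is 0 .

lift_definition plus_xy_alg :: "'a xy_alg \<Rightarrow> 'a xy_alg \<Rightarrow> 'a xy_alg" is "(+)"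
proof -
  fix f f' g g' :: "'a free_alg"
  assume "rel_cong f f'" "rel_cong g g'"
  moreover have "f + g - (f' + g') = (f - f') + (g - g')"
    by (simp add: algebra_simps)
  ultimately show "rel_cong (f + g) (f' + g')"
    unfolding rel_cong_def by (simp only: rel_ideal_add)
qed

lift_definition uminus_xy_alg :: "'a xy_alg \<Rightarrow> 'a xy_alg" is uminus
proof -
  fix f g :: "'a free_alg"
  assume "rel_cong f g"
  moreover have "- f - - g = - (f - g)"
    by simp
  ultimately show "rel_cong (- f) (- g)"
    unfolding rel_cong_def by (simp only: rel_ideal_minus)
qed

lift_definition minus_xy_alg :: "'a xy_alg \<Rightarrow> 'a xy_alg \<Rightarrow> 'a xy_alg" is "(-)"
proof -
  fix f f' g g' :: "'a free_alg"
  assume "rel_cong f f'" "rel_cong g g'"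
  moreover have "f - g - (f' - g') = (f - f') + - (g - g')"
    by (simp add: algebra_simps)
  ultimately show "rel_cong (f - g) (f' - g')"
    unfolding rel_cong_def by (simp only: rel_ideal_add rel_ideal_minus)
qed

lift_definition times_xy_alg :: "'a xy_alg \<Rightarrow> 'a xy_alg \<Rightarrow> 'a xy_alg" is "(*)"
  by (rule rel_cong_mult)

lift_definition one_xy_alg :: "'a xy_alg" is 1 .

instance
proof
  show "(0 :: 'a xy_alg) \<noteq> 1"
  proof transfer
    show "\<not> rel_cong 0 (1 :: 'a free_alg)"
      using rel_ideal_minus[of "- 1"] one_notin_rel_ideal by (auto simp: rel_cong_def)
  qed
qed (transfer, simp add: rel_cong_def rel_ideal_zero algebra_simps)+

end

lift_definition xy_scale :: "'k::field \<Rightarrow> 'k xy_alg \<Rightarrow> 'k xy_alg"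
  is "\<lambda>c f. scalar c * f"
  by (intro rel_cong_mult) (simp_all add: rel_cong_def rel_ideal_zero)

interpretation xy_alg: vector_space xy_scale
  by standard
    (transfer, simp add: rel_cong_def rel_ideal_zero scalar_def single_add mult_single
       single_one algebra_simps flip: mult.assoc)+

lift_definition xA :: "'k::field xy_alg" is "indet LX" .
lift_definition yA :: "'k::field xy_alg" is "indet LY" .

lemma xy_relation: "xA * yA - yA * xA = xA"
  by transfer (simp add: rel_cong_def rel_ideal_def hull_inc)

text \<open>
  As a subspace, the direct sum of the lines spanned by the monomials is their span; directness is
  the PBW theorem and is not built into the definition.
\<close>

definition W :: "'k::field xy_alg set" where
  "W = xy_alg.span {xA ^ m * yA ^ n | m n. m \<ge> 1}"

definition w :: "nat \<Rightarrow> nat \<Rightarrow> 'k::field xy_alg" where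
  "w k l = (xA * yA ^ k - yA ^ k * xA) * xA ^ l"

end

theory Submission
  imports Defs "HOL-Computational_Algebra.Polynomial"
begin

text \<open>
  The relation reads \<open>xy = (y + 1)x\<close>, so \<open>w\<^sub>k\<^sub>,\<^sub>l = ((y + 1)\<^sup>k - y\<^sup>k) x\<^sup>l\<^sup>+\<^sup>1\<close>, whose leading term in \<open>y\<close>
  is \<open>k y\<^sup>k\<^sup>-\<^sup>1 x\<^sup>l\<^sup>+\<^sup>1\<close>; in characteristic zero a triangular induction shows that the \<open>w\<^sub>k\<^sub>,\<^sub>l\<close> span the
  same subspace as the \<open>y\<^sup>n x\<^sup>m\<close> with \<open>m \<ge> 1\<close>, which is \<open>W\<close>. For independence no PBW theorem is
  needed: \<open>A\<close> acts on sequences \<open>g\<close> by \<open>(x g)(n) = g(n + 1)\<close> and \<open>(y g)(n) = n g(n)\<close>. Applying a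
  vanishing combination of the \<open>w\<^sub>k\<^sub>,\<^sub>l\<close> to the indicator of \<open>n + l + 1\<close> and evaluating at \<open>n\<close> shows that
  the polynomial \<open>q(t) = \<Sum>\<^sub>k a\<^sub>k\<^sub>,\<^sub>l t\<^sup>k\<close> satisfies \<open>q(n + 1) = q(n)\<close> and \<open>q(0) = 0\<close>, so \<open>q = 0\<close>.
\<close>

section \<open>The action on sequences\<close>

fun letter_act :: "letter \<Rightarrow> (nat \<Rightarrow> 'k) \<Rightarrow> nat \<Rightarrow> 'k::field" where
  "letter_act LX g n = g (Suc n)"
| "letter_act LY g n = of_nat n * g n"

text \<open>\<open>foldr\<close> lets the last letter act first, so concatenation of words becomes
  composition of operators and this is a left action.\<close>

definition word_act :: "word \<Rightarrow> (nat \<Rightarrow> 'k) \<Rightarrow> nat \<Rightarrow> 'k::field" where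
  "word_act u g = foldr letter_act (letters u) g"

lemma word_act_zero [simp]: "word_act 0 g = g"
  by (simp add: word_act_def zero_word_def)

lemma word_act_plus: "word_act (u + v) g = word_act u (word_act v g)"
  by (simp add: word_act_def plus_word_def)

lemma word_act_letter: "word_act (Word [a]) g = letter_act a g"
  by (simp add: word_act_def)

lemma letter_act_linear:
  "letter_act a (\<lambda>n. c * g n + h n) = (\<lambda>n. c * letter_act a g n + letter_act a h n)"
  by (cases a) (auto simp: algebra_simps)

lemma word_act_linear:
  "word_act u (\<lambda>n. c * g n + h n) = (\<lambda>n. c * word_act u g n + word_act u h n)"
proof -
  have "foldr letter_act ls (\<lambda>n. c * g n + h n) =
      (\<lambda>n. c * foldr letter_act ls g n + foldr letter_act ls h n)" for ls
    by (induction ls) (simp_all add: letter_act_linear)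
  then show ?thesis
    by (simp add: word_act_def)
qed

lemma word_act_0: "word_act u (\<lambda>n. 0) = (\<lambda>n. 0)"
  \<comment> \<open>With coefficient -1, linearity reads v = -v + v for v the image of the zero
    sequence.\<close>
  using word_act_linear[of u 0 "\<lambda>n. 0" "\<lambda>n. 0"] word_act_linear[of u "-1" "\<lambda>n. 0" "\<lambda>n. 0"]
  by (simp add: fun_eq_iff)

definition free_act :: "'k::field free_alg \<Rightarrow> (nat \<Rightarrow> 'k) \<Rightarrow> nat \<Rightarrow> 'k" where
  "free_act f g n = (\<Sum>u\<in>Poly_Mapping.keys f. Poly_Mapping.lookup f u * word_act u g n)"

text \<open>Allows sums over different supports to be compared over one common index set.\<close>

lemma free_act_superset:
  assumes "finite A" "Poly_Mapping.keys f \<subseteq> A"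
  shows "free_act f g n = (\<Sum>u\<in>A. Poly_Mapping.lookup f u * word_act u g n)"
  unfolding free_act_def using assms by (intro sum.mono_neutral_left) (auto simp: in_keys_iff)

lemma free_act_add: "free_act (f + f') g n = free_act f g n + free_act f' g n"
proof -
  let ?A = "Poly_Mapping.keys f \<union> Poly_Mapping.keys f'"
  have "Poly_Mapping.keys (f + f') \<subseteq> ?A"
    by (rule Poly_Mapping.keys_add)
  then show ?thesis
    by (simp add: free_act_superset[of ?A] lookup_add distrib_right sum.distrib)
qed

lemma free_act_zero [simp]: "free_act 0 g n = 0"
  by (simp add: free_act_def)

lemma free_act_uminus: "free_act (- f) g n = - free_act f g n"
  using free_act_add[of f "- f" g n] by (simp add: eq_neg_iff_add_eq_0 add.commute)

lemma free_act_diff: "free_act (f - f') g n = free_act f g n - free_act f' g n"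
  using free_act_add[of f "- f'" g n] by (simp add: free_act_uminus)

lemma free_act_single [simp]: "free_act (Poly_Mapping.single u c) g n = c * word_act u g n"
  by (simp add: free_act_def)

lemma free_act_vec_add: "free_act f (\<lambda>n. g n + h n) n = free_act f g n + free_act f h n"
  using word_act_linear[of _ 1 g h] by (simp add: free_act_def distrib_left sum.distrib)

lemma free_act_vec_0 [simp]: "free_act f (\<lambda>n. 0) n = 0"
  by (simp add: free_act_def word_act_0)

lemma poly_mapping_sum_induct [case_names single sum]:
  assumes single: "\<And>u c. P (Poly_Mapping.single u c)"
    and sum: "\<And>f g. P f \<Longrightarrow> P g \<Longrightarrow> P (f + g)"
  shows "P f"
proof (induction f rule: update_induct)
  case const
  show ?case
    using single[of undefined 0] by simp
next
  case (update f a b)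
  have "Poly_Mapping.update a b f = f + Poly_Mapping.single a b"
    using update(1)
    by (intro poly_mapping_eqI) (auto simp: lookup_update lookup_add lookup_single in_keys_iff)
  then show ?case
    using sum[OF update(3) single] by simp
qed

text \<open>Both sides are additive in \<open>f\<close> and in \<open>f'\<close>, which reduces the
  claim to multiples of single words; there it is \<open>word_act_plus\<close>.\<close>

lemma free_act_mult: "free_act (f * f') g n = free_act f (free_act f' g) n"
proof (induction f arbitrary: n rule: poly_mapping_sum_induct)
  case (single u c)
  show ?case
  proof (induction f' arbitrary: n rule: poly_mapping_sum_induct)
    case (single v d)
    show ?case
      using word_act_linear[of u d "word_act v g" "\<lambda>n. 0"]
      by (simp add: mult_single word_act_plus free_act_single[abs_def] word_act_0)
  next
    case (sum f1 f2)
    then show ?case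
      by (simp only: distrib_left free_act_add free_act_add[abs_def] free_act_vec_add)
  qed
next
  case (sum f1 f2)
  then show ?case
    by (simp only: distrib_right free_act_add)
qed

text \<open>The elements acting as zero form a two-sided ideal. It contains the generator because (n
  + 1) g(n + 1) - n g(n + 1) = g(n + 1), hence it contains the hull.\<close>

lemma free_act_rel_ideal:
  assumes "f \<in> rel_ideal"
  shows "free_act f g n = 0"
proof -
  let ?J = "{f :: 'a free_alg. \<forall>g n. free_act f g n = 0}"
  have "free_act (r * a) g n = 0" if "\<forall>g n. free_act a g n = 0" for r a :: "'a free_alg" and g n
  proof -
    have "free_act a g = (\<lambda>n. 0)"
      using that by auto
    then show ?thesis
      by (simp add: free_act_mult)
  qed
  then have "two_sided_ideal ?J"
    by (simp add: two_sided_ideal_def free_act_add) (simp add: free_act_mult)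
  moreover have "indet LX * indet LY - indet LY * indet LX - indet LX \<in> ?J"
    by (simp add: free_act_diff free_act_mult)
      (simp add: indet_def word_act_letter algebra_simps)
  ultimately have "rel_ideal \<subseteq> ?J"
    unfolding rel_ideal_def by (intro hull_minimal) auto
  with assms show ?thesis
    by auto
qed

lift_definition act :: "'k::field xy_alg \<Rightarrow> (nat \<Rightarrow> 'k) \<Rightarrow> nat \<Rightarrow> 'k" is free_act
proof (intro ext)
  fix f f' :: "'k free_alg" and g n
  assume "rel_cong f f'"
  then show "free_act f g n = free_act f' g n"
    using free_act_rel_ideal[of "f - f'" g n] by (simp add: rel_cong_def free_act_diff)
qed

lemma act_add: "act (a + b) g n = act a g n + act b g n"
  by transfer (rule free_act_add)

lemma act_diff: "act (a - b) g n = act a g n - act b g n"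
  by transfer (rule free_act_diff)

lemma act_mult: "act (a * b) g n = act a (act b g) n"
  by transfer (rule free_act_mult)

lemma act_zero [simp]: "act 0 g n = 0"
  by transfer simp

lemma act_one [simp]: "act 1 g n = g n"
  by transfer (simp flip: single_one)

lemma act_scale: "act (xy_scale c a) g n = c * act a g n"
  by transfer (simp add: scalar_def free_act_mult)

lemma act_sum: "act (sum f S) g n = (\<Sum>i\<in>S. act (f i) g n)"
  by (induction S rule: infinite_finite_induct) (simp_all add: act_add)

lemma act_xA [simp]: "act xA g n = g (Suc n)"
  by transfer (simp add: indet_def word_act_letter)

lemma act_yA [simp]: "act yA g n = of_nat n * g n"
  by transfer (simp add: indet_def word_act_letter)

lemma act_xA_power: "act (xA ^ m) g n = g (n + m)"
  by (induction m arbitrary: n) (simp_all add: act_mult)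

lemma act_yA_power: "act (yA ^ m) g n = of_nat n ^ m * g n"
  by (induction m arbitrary: n) (simp_all add: act_mult)

lemma act_w: "act (w k l) g n = ((of_nat n + 1) ^ k - of_nat n ^ k) * g (n + l + 1)"
  by (simp add: w_def act_mult act_diff act_xA_power act_yA_power algebra_simps)

section \<open>Linear independence\<close>

lemma w_family_independent:
  fixes a :: "nat \<times> nat \<Rightarrow> 'k::field_char_0"
  assumes fin: "finite S" and S: "S \<subseteq> {(k, l). k \<ge> 1}"
    and zero: "(\<Sum>(k, l)\<in>S. xy_scale (a (k, l)) (w k l)) = 0"
    and mem: "(k, l) \<in> S"
  shows "a (k, l) = 0"
proof -
  define T where "T = {i. (i, l) \<in> S}"
  have "T \<subseteq> fst ` S"
    by (force simp: T_def)
  with fin have finT: "finite T"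
    by (auto intro: finite_subset)
  define q where "q = (\<Sum>i\<in>T. monom (a (i, l)) i)"
  have poly_q: "poly q t = (\<Sum>i\<in>T. a (i, l) * t ^ i)" for t
    by (simp add: q_def poly_sum poly_monom)
  have step: "poly q (of_nat n + 1) = poly q (of_nat n)" for n
  proof -
    let ?c = "\<lambda>i. (of_nat n + 1) ^ i - of_nat n ^ i :: 'k"
    \<comment> \<open>By \<open>act_w\<close>, evaluation at \<open>n\<close> only sees the value of
      the sequence at n + j + 1, so this indicator keeps exactly the terms with j = l.\<close>
    have "0 = act (\<Sum>(i, j)\<in>S. xy_scale (a (i, j)) (w i j)) (\<lambda>m. if m = n + l + 1 then 1 else 0) n"
      by (simp add: zero)
    also have "\<dots> = (\<Sum>(i, j)\<in>S. if j = l then a (i, j) * ?c i else 0)"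
      unfolding act_sum by (intro sum.cong) (auto simp: act_scale act_w)
    also have "\<dots> = (\<Sum>(i, j)\<in>(\<lambda>i. (i, l)) ` T. a (i, j) * ?c i)"
      using fin by (intro sum.mono_neutral_cong_right) (auto simp: T_def)
    also have "\<dots> = (\<Sum>i\<in>T. a (i, l) * ?c i)"
      by (subst sum.reindex) (auto simp: inj_on_def)
    finally show ?thesis
      by (simp add: poly_q right_diff_distrib sum_subtractf)
  qed
  \<comment> \<open>The condition k \<ge> 1 removes the constant term of \<open>q\<close>, which
    starts the induction at q(0) = 0.\<close>
  have "0 \<notin> T"
    using S by (auto simp: T_def)
  have "poly q (of_nat n) = 0" for n
  proof (induction n)
    case 0
    show ?case
      using \<open>0 \<notin> T\<close> by (auto simp: poly_q power_0_left intro!: sum.neutral)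
  next
    case (Suc n)
    then show ?case
      using step[of n] by (simp add: add.commute)
  qed
  then have "range of_nat \<subseteq> {t. poly q t = 0}"
    by auto
  moreover have "infinite (range (of_nat :: nat \<Rightarrow> 'k))"
    by (simp add: infinite_UNIV_char_0 finite_image_iff inj_of_nat)
  ultimately have "q = 0"
    using poly_roots_finite[of q] finite_subset by blast
  then have "coeff q k = 0"
    by simp
  moreover have "coeff q k = a (k, l)"
    using finT mem by (simp add: q_def coeff_sum T_def)
  ultimately show ?thesis
    by simp
qed

text \<open>A coincidence of two members would be a vanishing combination with coefficients 1 and
  -1.\<close>

lemma inj_on_w: "inj_on (\<lambda>(k, l). w k l :: 'k::field_char_0 xy_alg) {(k, l). k \<ge> 1}"
proof (intro inj_onI, rule ccontr)
  fix p p' :: "nat \<times> nat"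
  assume p: "p \<in> {(k, l). k \<ge> 1}" "p' \<in> {(k, l). k \<ge> 1}" "p \<noteq> p'"
    and eq: "(\<lambda>(k, l). w k l :: 'k xy_alg) p = (\<lambda>(k, l). w k l) p'"
  let ?a = "(\<lambda>_. 0)(p := 1, p' := - 1) :: nat \<times> nat \<Rightarrow> 'k"
  have "(\<Sum>(k, l)\<in>{p, p'}. xy_scale (?a (k, l)) (w k l)) = 0"
    using p eq by (auto simp: split_beta xy_alg.scale_minus_left)
  then have "?a p = 0"
    using w_family_independent[of "{p, p'}" ?a "fst p" "snd p"] p by auto
  with p show False
    by simp
qed

lemma independent_w: "xy_alg.independent {w k l :: 'k::field_char_0 xy_alg | k l. k \<ge> 1}"
  unfolding xy_alg.independent_explicit_finite_subsets
proof (intro allI impI ballI)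
  fix B and a :: "'k xy_alg \<Rightarrow> 'k" and b
  assume B: "B \<subseteq> {w k l :: 'k xy_alg | k l. k \<ge> 1}" "finite B"
    and zero: "(\<Sum>b\<in>B. xy_scale (a b) b) = 0" and b: "b \<in> B"
  let ?f = "\<lambda>(k, l). w k l :: 'k xy_alg"
  have "B \<subseteq> ?f ` {(k, l). k \<ge> 1}"
    using B(1) by fastforce
  \<comment> \<open>The finite set of vectors is pulled back to a finite set of indices; injectivity
    turns the sum over vectors into a sum over indices.\<close>
  with B(2) obtain S where S: "S \<subseteq> {(k, l). k \<ge> 1}" "finite S" "B = ?f ` S"
    using finite_subset_image by metis
  have inj: "inj_on ?f S"
    using inj_on_w S(1) by (rule inj_on_subset)
  have "(\<Sum>(k, l)\<in>S. xy_scale (a (?f (k, l))) (w k l)) = 0"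
    using zero unfolding S(3) by (subst (asm) sum.reindex[OF inj]) (simp add: split_beta)
  then show "a b = 0"
    using w_family_independent[OF S(2,1), of "\<lambda>p. a (?f p)"] b S(3) by auto
qed

section \<open>Spanning\<close>

text \<open>Scalars sit on the empty word, which commutes with every word. This makes right factors
  linear in \<open>scale_mult_right\<close>.\<close>

lemma scalar_mult_commute: "scalar c * f = f * scalar c"
  by (induction f rule: poly_mapping_sum_induct)
    (simp_all add: scalar_def mult_single mult.commute distrib_left distrib_right)

lemma scale_mult_left: "xy_scale c a * b = xy_scale c (a * b)"
  by transfer (simp add: rel_cong_def rel_ideal_zero mult.assoc)

lemma scale_mult_right: "a * xy_scale c b = xy_scale c (a * b)"
  by transfer (simp add: rel_cong_def rel_ideal_zero scalar_mult_commute mult.assoc)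

text \<open>The vectors that \<open>a\<close> multiplies into \<open>V\<close> form a subspace, so
  generators suffice.\<close>

lemma mult_left_span:
  assumes v: "v \<in> xy_alg.span B" and V: "xy_alg.subspace V" and B: "\<And>b. b \<in> B \<Longrightarrow> a * b \<in> V"
  shows "a * v \<in> V"
  using v
proof (induction rule: xy_alg.span_induct)
  case base
  show ?case
    using V by (auto simp: xy_alg.subspace_def distrib_left scale_mult_right)
qed (rule B)

lemma mult_right_span:
  assumes v: "v \<in> xy_alg.span B" and V: "xy_alg.subspace V" and B: "\<And>b. b \<in> B \<Longrightarrow> b * a \<in> V"
  shows "v * a \<in> V"
  using v
proof (induction rule: xy_alg.span_induct)
  case base
  show ?case
    using V by (auto simp: xy_alg.subspace_def distrib_right scale_mult_left)
qed (rule B)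

section \<open>Normal ordering of monomials\<close>

lemma xA_power_mult_yA: "xA ^ m * yA = yA * xA ^ m + xy_scale (of_nat m) (xA ^ m)"
proof (induction m)
  case (Suc m)
  have xy: "xA * yA = yA * xA + (xA :: 'a xy_alg)"
    using xy_relation by (metis add.commute diff_eq_eq)
  have "xA ^ Suc m * yA = xA * (xA ^ m * yA :: 'a xy_alg)"
    by (simp add: mult.assoc)
  also have "\<dots> = xA * yA * xA ^ m + xy_scale (of_nat m) (xA ^ Suc m)"
    by (simp add: Suc distrib_left scale_mult_right mult.assoc)
  also have "\<dots> = yA * xA ^ Suc m + xy_scale (of_nat (Suc m)) (xA ^ Suc m)"
    by (simp add: xy distrib_right mult.assoc xy_alg.scale_left_distrib)
  finally show ?case .
qed simp

text \<open>The space \<open>W\<close> with the powers of y written on the left, the order in which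
  the \<open>w k l\<close> expand naturally.\<close>

definition W' :: "'k::field xy_alg set" where
  "W' = xy_alg.span {yA ^ n * xA ^ m | n m. m \<ge> 1}"

lemma W'_base: "m \<ge> 1 \<Longrightarrow> yA ^ n * xA ^ m \<in> W'"
  unfolding W'_def by (rule xy_alg.span_base) blast

lemma W_base: "m \<ge> 1 \<Longrightarrow> xA ^ m * yA ^ n \<in> W"
  unfolding W_def by (rule xy_alg.span_base) blast

lemma subspace_W: "xy_alg.subspace W"
  unfolding W_def by (rule xy_alg.subspace_span)

lemma subspace_W': "xy_alg.subspace W'"
  unfolding W'_def by (rule xy_alg.subspace_span)

text \<open>Moving y to the left past x^m leaves the exponent of x unchanged, so it stays
  positive.\<close>

lemma W'_mult_yA:
  assumes "v \<in> W'"
  shows "v * yA \<in> W'"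
proof (rule mult_right_span[OF assms[unfolded W'_def] subspace_W'], clarify)
  fix n m :: nat
  assume "m \<ge> 1"
  then have "yA ^ Suc n * xA ^ m + xy_scale (of_nat m) (yA ^ n * xA ^ m :: 'a xy_alg) \<in> W'"
    by (intro xy_alg.subspace_add[OF subspace_W'] xy_alg.subspace_scale[OF subspace_W'] W'_base)
  also have "yA ^ Suc n * xA ^ m + xy_scale (of_nat m) (yA ^ n * xA ^ m) = yA ^ n * xA ^ m * (yA :: 'a xy_alg)"
    by (simp add: mult.assoc xA_power_mult_yA distrib_left scale_mult_right power_Suc2 del: power_Suc)
  finally show "yA ^ n * xA ^ m * yA \<in> (W' :: 'a xy_alg set)" .
qed

lemma W'_mult_xA:
  assumes "v \<in> W'"
  shows "v * xA \<in> W'"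
proof (rule mult_right_span[OF assms[unfolded W'_def] subspace_W'], clarify)
  fix n m :: nat
  have "yA ^ n * xA ^ m * xA = yA ^ n * (xA ^ Suc m :: 'a xy_alg)"
    by (simp add: mult.assoc power_Suc2 del: power_Suc)
  with W'_base[of "Suc m" n] show "yA ^ n * xA ^ m * xA \<in> (W' :: 'a xy_alg set)"
    by simp
qed

lemma W_mult_yA:
  assumes "v \<in> W"
  shows "yA * v \<in> W"
proof (rule mult_left_span[OF assms[unfolded W_def] subspace_W], clarify)
  fix m n :: nat
  assume "m \<ge> 1"
  then have "xA ^ m * yA ^ Suc n - xy_scale (of_nat m) (xA ^ m * yA ^ n :: 'a xy_alg) \<in> W"
    by (intro xy_alg.subspace_diff[OF subspace_W] xy_alg.subspace_scale[OF subspace_W] W_base)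
  also have "xA ^ m * yA ^ Suc n - xy_scale (of_nat m) (xA ^ m * yA ^ n) =
      (xA ^ m * yA - xy_scale (of_nat m) (xA ^ m)) * (yA ^ n :: 'a xy_alg)"
    by (simp add: left_diff_distrib scale_mult_left mult.assoc)
  also have "\<dots> = yA * (xA ^ m * yA ^ n)"
    by (simp add: xA_power_mult_yA mult.assoc)
  finally show "yA * (xA ^ m * yA ^ n) \<in> (W :: 'a xy_alg set)" .
qed

lemma W'_mult_powers: "v \<in> W' \<Longrightarrow> v * yA ^ n \<in> W'" "v \<in> W' \<Longrightarrow> v * xA ^ n \<in> W'"
  by (induction n) (simp_all add: W'_mult_yA W'_mult_xA power_Suc2 del: power_Suc flip: mult.assoc)

text \<open>Each inclusion starts from x^m and adjoins the factors y one at a time, on the left for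
  \<open>W\<close> and on the right for \<open>W'\<close>.\<close>

lemma W'_eq_W: "W' = W"
proof
  have "yA ^ n * xA ^ m \<in> W" if "m \<ge> 1" for n m
  proof (induction n)
    case 0
    show ?case
      using W_base[OF that, of 0] by simp
  qed (simp add: mult.assoc W_mult_yA)
  then show "W' \<subseteq> (W :: 'a xy_alg set)"
    unfolding W'_def by (intro xy_alg.span_minimal) (auto simp: W_def)
  have "xA ^ m * yA ^ n \<in> (W' :: 'a xy_alg set)" if "m \<ge> 1" for m n
    using W'_base[OF that, of 0, where 'a='a] by (simp add: W'_mult_powers)
  then show "W \<subseteq> (W' :: 'a xy_alg set)"
    unfolding W_def by (intro xy_alg.span_minimal) (auto simp: W'_def)
qed

lemma w_in_W': "w k l \<in> W'"
proof -
  have "xA * yA ^ k * xA ^ l \<in> (W' :: 'a xy_alg set)"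
    using W'_base[of 1 0, where 'a='a] by (simp add: W'_mult_powers)
  moreover have "yA ^ k * xA ^ Suc l \<in> (W' :: 'a xy_alg set)"
    by (rule W'_base) simp
  moreover have "w k l = xA * yA ^ k * xA ^ l - yA ^ k * (xA ^ Suc l :: 'a xy_alg)"
    by (simp add: w_def left_diff_distrib mult.assoc)
  ultimately show ?thesis
    by (simp add: xy_alg.subspace_diff[OF subspace_W'])
qed

section \<open>Triangularity in the degree of y\<close>

lemma w_Suc: "w (Suc k) l = w k l + yA ^ k * xA ^ Suc l + yA * w k l"
proof -
  \<comment> \<open>Leibniz rule: [x, y y^k] = [x, y] y^k + y [x, y^k].\<close>
  have "w (Suc k) l = (xA * yA - yA * xA) * yA ^ k * xA ^ l + yA * (w k l :: 'a xy_alg)"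
    by (simp add: w_def algebra_simps)
  then show ?thesis
    by (simp add: xy_relation) (simp add: w_def algebra_simps)
qed

text \<open>Writing r(n) for the remainder and b(n) for y^n x^(l+1), \<open>w_Suc\<close> gives r(n
  + 1) = r(n) + (n + 1) b(n) + y r(n), and multiplication by y raises degrees by only one.\<close>

lemma w_leading_term:
  "w (Suc n) l - xy_scale (of_nat (Suc n)) (yA ^ n * xA ^ Suc l) \<in>
     xy_alg.span {yA ^ j * xA ^ Suc l | j. j < n}"
    (is "?r n \<in> ?L n")
proof (induction n)
  case 0
  show ?case
    by (simp add: w_def xy_relation xy_alg.span_zero)
next
  case (Suc n)
  let ?b = "\<lambda>j. yA ^ j * xA ^ Suc l :: 'a xy_alg"
  have b: "?b j \<in> ?L (Suc n)" if "j \<le> n" for j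
    using that by (intro xy_alg.span_base) auto
  have "?L n \<subseteq> ?L (Suc n)"
    by (intro xy_alg.span_mono) auto
  with Suc have "?r n \<in> ?L (Suc n)"
    by blast
  moreover have "yA * ?r n \<in> ?L (Suc n)"
    using Suc xy_alg.subspace_span
  proof (rule mult_left_span)
    fix v assume "v \<in> {?b j | j. j < n}"
    then obtain j where j: "j < n" "v = ?b j"
      by blast
    then have "yA * v = ?b (Suc j)"
      by (simp add: mult.assoc)
    with j b[of "Suc j"] show "yA * v \<in> ?L (Suc n)"
      by simp
  qed
  moreover have "?r (Suc n) = ?r n + xy_scale (of_nat (Suc n)) (?b n) + yA * ?r n"
  proof -
    have "xy_scale (of_nat (Suc (Suc n))) (?b (Suc n)) = xy_scale (of_nat (Suc n)) (?b (Suc n)) + ?b (Suc n)"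
      by (simp only: of_nat_Suc[of "Suc n"] xy_alg.scale_left_distrib xy_alg.scale_one add.commute)
    moreover have "yA * ?r n = yA * w (Suc n) l - xy_scale (of_nat (Suc n)) (?b (Suc n))"
      by (simp only: right_diff_distrib scale_mult_right mult.assoc power_Suc)
    ultimately show ?thesis
      by (simp only: w_Suc[of "Suc n"]) (simp del: of_nat_Suc power_Suc)
  qed
  ultimately show ?case
    using b[of n] by (simp only: xy_alg.span_add xy_alg.span_scale order_refl)
qed

lemma basis_in_span_w:
  fixes l n :: nat
  defines "V \<equiv> xy_alg.span {w k l :: 'k::field_char_0 xy_alg | k l. k \<ge> 1}"
  shows "yA ^ n * xA ^ Suc l \<in> V"
proof (induction n rule: less_induct)
  case (less n)
  let ?c = "of_nat (Suc n) :: 'k" and ?b = "yA ^ n * xA ^ Suc l :: 'k xy_alg"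
  have "w (Suc n) l \<in> V"
    unfolding V_def by (rule xy_alg.span_base) auto
  have "xy_alg.span {yA ^ j * xA ^ Suc l | j. j < n} \<subseteq> V"
    unfolding V_def using less by (intro xy_alg.span_minimal) (auto simp: V_def)
  then have "w (Suc n) l - xy_scale ?c ?b \<in> V"
    using w_leading_term by blast
  with \<open>w (Suc n) l \<in> V\<close> have "w (Suc n) l - (w (Suc n) l - xy_scale ?c ?b) \<in> V"
    unfolding V_def by (rule xy_alg.span_diff)
  then have "xy_scale ?c ?b \<in> V"
    by (simp only: diff_diff_eq2 add_diff_cancel_left')
  then have "xy_scale (inverse ?c) (xy_scale ?c ?b) \<in> V"
    unfolding V_def by (rule xy_alg.span_scale)
  \<comment> \<open>Characteristic zero makes the leading coefficient n + 1 invertible.\<close>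
  moreover have "?c \<noteq> 0"
    by (rule of_nat_neq_0)
  ultimately show ?case
    by (simp del: of_nat_Suc)
qed

lemma span_w: "xy_alg.span {w k l :: 'k::field_char_0 xy_alg | k l. k \<ge> 1} = W"
proof
  show "xy_alg.span {w k l :: 'k xy_alg | k l. k \<ge> 1} \<subseteq> W"
    unfolding W'_eq_W[symmetric] W'_def
    using w_in_W' by (intro xy_alg.span_minimal) (auto simp: W'_def)
  have "yA ^ n * xA ^ m \<in> xy_alg.span {w k l :: 'k xy_alg | k l. k \<ge> 1}" if "m \<ge> 1" for n m
    using basis_in_span_w[of n "m - 1"] that by simp
  then show "W \<subseteq> xy_alg.span {w k l :: 'k xy_alg | k l. k \<ge> 1}"
    unfolding W'_eq_W[symmetric] W'_def by (intro xy_alg.span_minimal) auto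
qed

text \<open>Independence and span concern the set of all \<open>w k l\<close>; injectivity of the
  indexing makes the indexed family itself a basis.\<close>

theorem corollary3p4:
  shows "inj_on (\<lambda>(k, l). w k l :: 'k::field_char_0 xy_alg) {(k, l). k \<ge> 1}
    \<and> xy_alg.independent {w k l :: 'k xy_alg | k l. k \<ge> 1}
    \<and> xy_alg.span {w k l :: 'k xy_alg | k l. k \<ge> 1} = W"
  using inj_on_w independent_w span_w by blast

end
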